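(* Let $b, m, k$ be integers with $b\geq k\geq 3$ and $m\geq 1$. Let $T$ be a tree with exactly $b$ leaves and maximum matching number $m$. Then $\sigma_k(T)\leq 1$. Moreover, the spider graph $Sp_{1,\,b-1;\,2m-1,\,1}$ has $b$ leaves, maximum matching number $m$, and satisfies $\sigma_k(Sp_{1,b-1;2m-1,1})=1$.
   Context: For a finite tree $T=(V,E)$, the boundary $B$ is the set of leaves. For $f\in\mathbb{R}^B$ let $\hat f$ be the harmonic extension: $\hat f=f$ on $B$ and $\sum_{y\sim x}(\hat f(x)-\hat f(y))=0$ for $x\in V\setminus B$. The Steklov operator is $\Lambda f(x)=\sum_{y\sim x}(\hat f(x)-\hat f(y))$, $x\in B$, with eigenvalues $0=\sigma_1(T)\leq\sigma_2(T)\leq\cdots\leq\sigma_{|B|}(T)$. The maximum matching number is the largest number of pairwise vertex-disjoint edges. For nonnegative integers $p_1,p_2$ with $p_1+p_2\geq2$ and integers $\ell_1\geq\ell_2\geq1$, the spider graph $Sp_{p_1,p_2;\ell_1,\ell_2}$ is obtained by taking $p_1$ paths of length $\ell_1$ and $p_2$ paths of length $\ell_2$ (length = number of edges) and identifying one endpoint of each into a single vertex. *)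

theory Defs
  imports
    "Graph_Theory.Graph_Theory"
    "Jordan_Normal_Form.Char_Poly"
begin

text \<open>
  A finite simple graph is a \<open>pair_graph\<close>: an edge \<open>{x, y}\<close> is stored as the two arcs
  \<open>(x, y)\<close> and \<open>(y, x)\<close>. The predicate \<open>Digraph_Component.tree\<close> forbids directed cycles
  and so counts \<open>x, y, x\<close> as a cycle; it is never satisfied by a symmetric digraph with an
  edge. For undirected graphs only cycles of length at least 3 are to be excluded.
\<close>

definition undirected_tree :: "'a pair_pre_digraph \<Rightarrow> bool" where
  "undirected_tree G \<longleftrightarrow>
     pair_graph G \<and> Digraph_Component.connected (with_proj G) \<and>
     \<not> (\<exists>p. pre_digraph.cycle (with_proj G) p \<and> length p \<ge> 3)"

definition leaves :: "'a pair_pre_digraph \<Rightarrow> 'a set" where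
  "leaves G = {x \<in> pverts G. out_degree (with_proj G) x = 1}"

definition undirected_edges :: "'a pair_pre_digraph \<Rightarrow> 'a set set" where
  "undirected_edges G = {{x, y} | x y. (x, y) \<in> parcs G}"

definition matching_number :: "'a pair_pre_digraph \<Rightarrow> nat" where
  "matching_number G = Max (card ` {M. M \<subseteq> undirected_edges G \<and> pairwise disjnt M})"

definition laplacian :: "'a pair_pre_digraph \<Rightarrow> ('a \<Rightarrow> real) \<Rightarrow> 'a \<Rightarrow> real" where
  "laplacian G h x = (\<Sum>y | (x, y) \<in> parcs G. h x - h y)"

text \<open>
  Functions on a set of vertices are total functions on \<open>'a\<close>. Fixing the value 0 outside the
  vertex set makes the harmonic extension unique as a total function; only the values of \<open>f\<close>
  on the leaves matter.
\<close>

definition harmonic_extension :: "'a pair_pre_digraph \<Rightarrow> ('a \<Rightarrow> real) \<Rightarrow> 'a \<Rightarrow> real" where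
  "harmonic_extension G f =
     (THE h. (\<forall>x\<in>leaves G. h x = f x) \<and>
             (\<forall>x\<in>pverts G - leaves G. laplacian G h x = 0) \<and>
             (\<forall>x. x \<notin> pverts G \<longrightarrow> h x = 0))"

definition steklov :: "'a pair_pre_digraph \<Rightarrow> ('a \<Rightarrow> real) \<Rightarrow> 'a \<Rightarrow> real" where
  "steklov G f x = laplacian G (harmonic_extension G f) x"

text \<open>
  The matrix of the Steklov operator in the standard basis of the functions on the leaves. The
  enumeration of the leaves is arbitrary; another one conjugates the matrix by a permutation
  and leaves its characteristic polynomial unchanged.
\<close>

definition leaf_list :: "'a pair_pre_digraph \<Rightarrow> 'a list" where
  "leaf_list G = (SOME xs. distinct xs \<and> set xs = leaves G)"

definition steklov_mat :: "'a pair_pre_digraph \<Rightarrow> real mat" where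
  "steklov_mat G =
     mat (card (leaves G)) (card (leaves G))
       (\<lambda>(i, j). steklov G (\<lambda>x. if x = leaf_list G ! j then 1 else 0) (leaf_list G ! i))"

text \<open>
  Eigenvalues are listed in increasing order with their multiplicity as roots of the
  characteristic polynomial; \<open>\<sigma>\<^sub>k\<close> is \<open>steklov_eigenvalue G k\<close>, with \<open>k\<close> starting at 1.
\<close>

definition steklov_eigenvalue :: "'a pair_pre_digraph \<Rightarrow> nat \<Rightarrow> real" where
  "steklov_eigenvalue G k =
     sorted_list_of_multiset (proots (char_poly (steklov_mat G))) ! (k - 1)"

text \<open>
  Leg \<open>i < p\<^sub>1 + p\<^sub>2\<close> of the spider has the vertices \<open>spider_vertex i j\<close>, where \<open>j\<close> is the distance
  from the centre; the vertices with \<open>j = 0\<close> are identified.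
\<close>

definition spider_vertex :: "nat \<Rightarrow> nat \<Rightarrow> nat \<times> nat" where
  "spider_vertex i j = (if j = 0 then (0, 0) else (i, j))"

definition spider_leg :: "nat \<Rightarrow> nat \<Rightarrow> nat \<Rightarrow> nat \<Rightarrow> nat" where
  "spider_leg p1 l1 l2 i = (if i < p1 then l1 else l2)"

definition spider_arcs :: "nat \<Rightarrow> nat \<Rightarrow> nat \<Rightarrow> nat \<Rightarrow> ((nat \<times> nat) \<times> (nat \<times> nat)) set" where
  "spider_arcs p1 p2 l1 l2 =
     {(spider_vertex i j, spider_vertex i (Suc j)) | i j.
        i < p1 + p2 \<and> j < spider_leg p1 l1 l2 i}"

definition spider :: "nat \<Rightarrow> nat \<Rightarrow> nat \<Rightarrow> nat \<Rightarrow> (nat \<times> nat) pair_pre_digraph" where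
  "spider p1 p2 l1 l2 =
     \<lparr> pverts = {spider_vertex i j | i j. i < p1 + p2 \<and> j \<le> spider_leg p1 l1 l2 i},
       parcs = spider_arcs p1 p2 l1 l2 \<union> (spider_arcs p1 p2 l1 l2)\<inverse> \<rparr>"

end

theory Submission
  imports Defs
begin

text \<open>
  In a connected graph with at least three leaves no two leaves are adjacent, so a function \<open>f\<close> on
  the leaves, extended by 0, has energy \<open>\<Sum> f\<^sup>2\<close>. The harmonic extension minimises the energy, so every
  Rayleigh quotient of the symmetric Steklov operator, and hence every eigenvalue, is at most 1.
  If \<open>s\<close> leaves have a common neighbour \<open>z\<close>, the rows of \<open>1 - \<Lambda>\<close> at these leaves coincide, since all
  are given by evaluation of the harmonic extension at \<open>z\<close>; so 1 is an eigenvalue of multiplicity at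
  least \<open>s - 1\<close>. In the spider \<open>s = b - 1\<close>, which leaves room for only two eigenvalues below 1.
\<close>

section \<open>Linear algebra\<close>

text \<open>For an eigenvector \<open>v\<close>, the Hermitian form \<open>q\<close> equals
  \<open>c\<close> times the squared norm \<open>r\<close>. Symmetry of \<open>A\<close> makes
  \<open>q\<close> its own conjugate, so \<open>c\<close> is a quotient of real numbers with nonzero
  denominator.\<close>

lemma real_eigenvalue_of_real_symmetric_mat:
  fixes A :: "real mat"
  assumes A: "A \<in> carrier_mat n n"
    and sym: "\<And>i j. i < n \<Longrightarrow> j < n \<Longrightarrow> A $$ (i, j) = A $$ (j, i)"
    and ev: "eigenvalue (map_mat complex_of_real A) c"
  shows "c \<in> \<real>"
proof -
  from ev A obtain v where v: "v \<in> carrier_vec n" "v \<noteq> 0\<^sub>v n"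
    and Av: "map_mat complex_of_real A *\<^sub>v v = c \<cdot>\<^sub>v v"
    unfolding eigenvalue_def eigenvector_def by auto
  define q where "q = (\<Sum>i<n. \<Sum>j<n. cnj (v $ i) * A $$ (i, j) * v $ j)"
  define r where "r = (\<Sum>i<n. (cmod (v $ i))\<^sup>2)"
  have row: "(\<Sum>j<n. A $$ (i, j) * v $ j) = c * v $ i" if "i < n" for i
    using arg_cong[OF Av, of "\<lambda>w. w $ i"] that A v
    by (simp add: scalar_prod_def lessThan_atLeast0)
  have "q = (\<Sum>i<n. cnj (v $ i) * (\<Sum>j<n. A $$ (i, j) * v $ j))"
    by (simp add: q_def sum_distrib_left mult.assoc)
  also have "\<dots> = (\<Sum>i<n. c * complex_of_real ((cmod (v $ i))\<^sup>2))"
    by (intro sum.cong refl)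
      (simp add: row complex_norm_square mult.left_commute mult.commute[of "cnj _"]
        del: of_real_power)
  also have "\<dots> = c * r"
    by (simp add: r_def sum_distrib_left)
  finally have qr: "q = c * r" .
  have "cnj q = (\<Sum>i<n. \<Sum>j<n. cnj (v $ j) * A $$ (j, i) * v $ i)"
    unfolding q_def cnj_sum using sym by (intro sum.cong refl) (simp add: ac_simps)
  also have "\<dots> = q"
    unfolding q_def by (rule sum.swap)
  finally have "q \<in> \<real>" by (simp add: Reals_cnj_iff)
  moreover have "r \<noteq> 0"
  proof
    assume "r = 0"
    then have "\<forall>i<n. v $ i = 0"
      by (auto simp: r_def sum_nonneg_eq_0_iff)
    with v show False by auto
  qed
  ultimately show ?thesis
    using qr by (metis Reals_divide Reals_of_real nonzero_mult_div_cancel_right of_real_eq_0_iff)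
qed

text \<open>The characteristic polynomial splits over the complex numbers. Its roots are eigenvalues
  and therefore real, so the factorization already holds over the reals and no root is lost in
  \<open>proots\<close>.\<close>

lemma size_proots_char_poly_symmetric:
  fixes A :: "real mat"
  assumes A: "A \<in> carrier_mat n n"
    and sym: "\<And>i j. i < n \<Longrightarrow> j < n \<Longrightarrow> A $$ (i, j) = A $$ (j, i)"
  shows "size (proots (char_poly A)) = n"
proof -
  have cA: "map_mat complex_of_real A \<in> carrier_mat n n" using A by simp
  from char_poly_factorized[OF cA] obtain as
    where as: "char_poly (map_mat complex_of_real A) = (\<Prod>a\<leftarrow>as. [:- a, 1:])" "length as = n"
    by blast
  have re: "complex_of_real (Re a) = a" if "a \<in> set as" for a
  proof -
    have "poly (char_poly (map_mat complex_of_real A)) a = 0"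
      using that by (simp add: as poly_prod_list prod_list_zero_iff)
    then have "eigenvalue (map_mat complex_of_real A) a"
      using eigenvalue_root_char_poly[OF cA] by blast
    from real_eigenvalue_of_real_symmetric_mat[OF A sym this] show ?thesis by simp
  qed
  \<comment> \<open>The product of the real linear factors and \<open>char_poly A\<close> have the
    same image under the injective embedding of coefficients, hence they agree.\<close>
  interpret H: map_poly_comm_ring_hom complex_of_real ..
  have "map_poly complex_of_real (\<Prod>a\<leftarrow>as. [:- Re a, 1:]) = (\<Prod>a\<leftarrow>as. [:- complex_of_real (Re a), 1:])"
  proof (induction as)
    case (Cons a as)
    then show ?case
      by (simp add: H.hom_mult del: mult_pCons_left)
  qed simp
  also have "\<dots> = (\<Prod>a\<leftarrow>as. [:- a, 1:])"
    using re by (intro arg_cong[of _ _ prod_list] map_cong) auto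
  also have "\<dots> = map_poly complex_of_real (char_poly A)"
    using as(1) of_real_hom.char_poly_hom[OF A, where 'a=complex] by simp
  finally have "char_poly A = (\<Prod>a\<leftarrow>as. [:- Re a, 1:])"
    by (simp add: poly_eq_iff coeff_map_poly)
  also have "proots \<dots> = mset (map Re as)"
  proof (induction as)
    case (Cons a as)
    have "(\<Prod>a\<leftarrow>as. [:- Re a, 1:]) \<noteq> 0" by (auto simp: prod_list_zero_iff)
    with Cons show ?case by (simp add: proots_mult del: mult_pCons_left)
  qed simp
  finally show ?thesis using as(2) by simp
qed

text \<open>Subtracting row \<open>l\<close> from each row in \<open>S\<close> preserves the
  determinant and leaves a factor \<open>c\<close> in every such row. With \<open>c\<close> the
  polynomial X - 1 this bounds an algebraic multiplicity from below without passing through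
  eigenspaces.\<close>

lemma power_dvd_det_if_rows_congruent:
  fixes M :: "'a :: comm_ring_1 mat"
  assumes "finite S" "M \<in> carrier_mat n n" "S \<subseteq> {..<n}" "l < n" "l \<notin> S"
    and "\<And>i j. i \<in> S \<Longrightarrow> j < n \<Longrightarrow> c dvd M $$ (i, j) - M $$ (l, j)"
  shows "c ^ card S dvd det M"
  using assms
proof (induction S arbitrary: M rule: finite_induct)
  case empty
  then show ?case by simp
next
  case (insert k S)
  have "\<forall>j<n. \<exists>r. M $$ (k, j) - M $$ (l, j) = c * r"
    using insert.prems(5) by (auto simp: dvd_def)
  then obtain r where r: "\<And>j. j < n \<Longrightarrow> M $$ (k, j) - M $$ (l, j) = c * r j"
    by metis
  \<comment> \<open>\<open>N\<close> carries the quotient by \<open>c\<close> in row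
    \<open>k\<close>. Row \<open>l\<close> and the rows in \<open>S\<close> are those of
    \<open>M\<close>, so the induction hypothesis applies to \<open>N\<close>.\<close>
  define N where "N = mat n n (\<lambda>(i, j). if i = k then r j else M $$ (i, j))"
  have N: "N \<in> carrier_mat n n" by (simp add: N_def)
  have kl: "k < n" "k \<noteq> l" using insert.prems by auto
  have "addrow (- 1) k l M = multrow k c N"
    using insert.prems(1) kl insert.prems(3) r[symmetric] by (intro eq_matI) (auto simp: N_def)
  then have "det M = c * det N"
    using det_addrow[OF insert.prems(3) kl(2) insert.prems(1), of "- 1"] det_multrow[OF kl(1) N, of c]
    by simp
  moreover have "c ^ card S dvd det N"
  proof (rule insert.IH[OF N])
    show "c dvd N $$ (i, j) - N $$ (l, j)" if "i \<in> S" "j < n" for i j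
    proof -
      have "i \<noteq> k" "i < n" using that insert.hyps insert.prems(2) by auto
      then show ?thesis using that kl insert.prems by (simp add: N_def)
    qed
  qed (use insert.prems in auto)
  ultimately show ?case using insert.hyps by (simp add: mult_dvd_mono)
qed

text \<open>At most \<open>d\<close> entries differ from the upper bound \<open>a\<close>. If entry
  \<open>i\<close> were below \<open>a\<close>, sortedness would make all \<open>i + 1 > d\<close>
  entries up to it differ from \<open>a\<close>.\<close>

lemma sorted_nth_eq_max_if_count:
  fixes M :: "'a :: linorder multiset"
  assumes "\<And>x. x \<in># M \<Longrightarrow> x \<le> a" "size M \<le> count M a + d" "d \<le> i" "i < size M"
  shows "sorted_list_of_multiset M ! i = a"
proof -
  let ?xs = "sorted_list_of_multiset M"
  have len: "length ?xs = size M" by (metis mset_sorted_list_of_multiset size_mset)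
  have srt: "sorted ?xs" by simp
  have "?xs ! i \<in># M"
    using assms(4) len by (metis mset_sorted_list_of_multiset nth_mem set_mset_mset)
  moreover have "\<not> ?xs ! i < a"
  proof
    assume lt: "?xs ! i < a"
    have "{..i} \<subseteq> {j. j < length ?xs \<and> ?xs ! j \<noteq> a}"
    proof
      fix j assume "j \<in> {..i}"
      then have "?xs ! j \<le> ?xs ! i" "j < length ?xs"
        using sorted_nth_mono[OF srt] assms(4) len by auto
      with lt show "j \<in> {j. j < length ?xs \<and> ?xs ! j \<noteq> a}" by auto
    qed
    from card_mono[OF _ this]
    have "i + 1 \<le> length (filter (\<lambda>x. x \<noteq> a) ?xs)"
      by (simp add: length_filter_conv_card)
    moreover have "length (filter (\<lambda>x. x = a) ?xs) = count M a"
    proof -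
      have "length (filter (\<lambda>x. x = a) xs) = count (mset xs) a" for xs :: "'a list"
        by (induction xs) auto
      from this[of ?xs] show ?thesis by simp
    qed
    moreover have "length (filter (\<lambda>x. x = a) ?xs) + length (filter (\<lambda>x. x \<noteq> a) ?xs) = size M"
      using sum_length_filter_compl[of "\<lambda>x. x = a" ?xs] len by simp
    ultimately show False using assms(2,3) by linarith
  qed
  ultimately show ?thesis using assms(1) by force
qed

section \<open>Linear operators on functions over a finite set, and their matrices\<close>

definition operator_mat :: "'a list \<Rightarrow> (('a \<Rightarrow> real) \<Rightarrow> 'a \<Rightarrow> real) \<Rightarrow> real mat" where
  "operator_mat xs L = mat (length xs) (length xs)
     (\<lambda>(i, j). L (\<lambda>x. if x = xs ! j then 1 else 0) (xs ! i))"

definition linear_operator :: "(('a \<Rightarrow> real) \<Rightarrow> 'a \<Rightarrow> real) \<Rightarrow> bool" where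
  "linear_operator L \<longleftrightarrow> (\<forall>u v c. L (\<lambda>x. u x + c * v x) = (\<lambda>x. L u x + c * L v x))"

lemma linear_operatorD:
  "linear_operator L \<Longrightarrow> L (\<lambda>x. u x + c * v x) z = L u z + c * L v z"
  by (simp add: linear_operator_def)

lemma linear_operator_sum:
  assumes "linear_operator L" "finite I"
  shows "L (\<lambda>z. \<Sum>j\<in>I. c j * u j z) x = (\<Sum>j\<in>I. c j * L (u j) x)"
  using assms(2)
proof (induction I rule: finite_induct)
  case empty
  show ?case
    \<comment> \<open>The scalar - 1 turns linearity at the zero function into L 0 = L 0 - L 0,
      which settles the empty sum.\<close>
    using linear_operatorD[OF assms(1), of "\<lambda>_. 0" "- 1" "\<lambda>_. 0" x] by simp
next
  case (insert k I)
  then show ?case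
    using linear_operatorD[OF assms(1), of "\<lambda>z. \<Sum>j\<in>I. c j * u j z" "c k" "u k" x]
    by (simp add: add.commute)
qed

text \<open>Written as a combination of indicator functions, not as a lookup, so that
  \<open>linear_operator_sum\<close> applies to it directly.\<close>

definition vec_fun :: "'a list \<Rightarrow> real vec \<Rightarrow> 'a \<Rightarrow> real" where
  "vec_fun xs v = (\<lambda>x. \<Sum>j<length xs. v $ j * (if x = xs ! j then 1 else 0))"

lemma vec_fun_nth:
  assumes "distinct xs" "i < length xs"
  shows "vec_fun xs v (xs ! i) = v $ i"
proof -
  have "vec_fun xs v (xs ! i) = (\<Sum>j<length xs. if j = i then v $ j else 0)"
    unfolding vec_fun_def using assms by (intro sum.cong) (auto simp: nth_eq_iff_index_eq)
  then show ?thesis using assms by simp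
qed

lemma vec_fun_outside: "x \<notin> set xs \<Longrightarrow> vec_fun xs v x = 0"
  unfolding vec_fun_def by (intro sum.neutral) auto

text \<open>This serves two matrices: the Steklov matrix on the leaves, and the linear system on all
  vertices that yields harmonic extensions.\<close>

lemma operator_mat_mult_vec:
  assumes "linear_operator L" "v \<in> carrier_vec (length xs)" "i < length xs"
  shows "(operator_mat xs L *\<^sub>v v) $ i = L (vec_fun xs v) (xs ! i)"
  unfolding vec_fun_def linear_operator_sum[OF assms(1) finite_lessThan]
  using assms by (simp add: operator_mat_def scalar_prod_def lessThan_atLeast0 mult.commute)

text \<open>A kernel vector of the square matrix \<open>A\<close> would give a nonzero function
  supported on \<open>S\<close> and killed by \<open>L\<close> there; so \<open>A\<close> is
  invertible. This turns uniqueness of harmonic extensions into existence.\<close>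

lemma linear_operator_injective_imp_surjective:
  assumes L: "linear_operator L" and "finite S"
    and inj: "\<And>u x. (\<forall>x\<in>S. L u x = 0) \<Longrightarrow> (\<forall>x. x \<notin> S \<longrightarrow> u x = 0) \<Longrightarrow> x \<in> S \<Longrightarrow> u x = 0"
  obtains u where "\<forall>x\<in>S. L u x = g x" "\<forall>x. x \<notin> S \<longrightarrow> u x = 0"
proof -
  obtain xs where xs: "set xs = S" "distinct xs"
    using \<open>finite S\<close> finite_distinct_list by blast
  define n where "n = length xs"
  define A where "A = operator_mat xs L"
  have A: "A \<in> carrier_mat n n" by (simp add: A_def operator_mat_def n_def)
  have "det A \<noteq> 0"
  proof
    assume "det A = 0"
    then obtain v where v: "v \<in> carrier_vec n" "v \<noteq> 0\<^sub>v n" "A *\<^sub>v v = 0\<^sub>v n"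
      using det_0_iff_vec_prod_zero[OF A] by blast
    have "\<forall>x\<in>S. L (vec_fun xs v) x = 0"
    proof
      fix x assume "x \<in> S"
      then obtain i where i: "i < n" "x = xs ! i" using xs by (auto simp: in_set_conv_nth n_def)
      then show "L (vec_fun xs v) x = 0"
        using operator_mat_mult_vec[OF L, of v xs i] v by (simp add: A_def n_def)
    qed
    then have "\<forall>x\<in>S. vec_fun xs v x = 0"
      using inj[of "vec_fun xs v"] vec_fun_outside xs(1) by metis
    then have "v $ i = 0" if "i < n" for i
      using that vec_fun_nth[OF xs(2), of i v] xs(1) by (metis n_def nth_mem)
    with v show False by auto
  qed
  from det_non_zero_imp_unit[OF A this, of "()"]
  obtain B where B: "B \<in> carrier_mat n n" "A * B = 1\<^sub>m n"
    unfolding Units_def ring_mat_def by auto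
  define w where "w = B *\<^sub>v vec n (\<lambda>i. g (xs ! i))"
  have w: "w \<in> carrier_vec n" using B by (simp add: w_def)
  have Aw: "A *\<^sub>v w = vec n (\<lambda>i. g (xs ! i))"
    unfolding w_def using A B by (metis assoc_mult_mat_vec one_mult_mat_vec vec_carrier)
  show ?thesis
  proof (rule that)
    show "\<forall>x\<in>S. L (vec_fun xs w) x = g x"
    proof
      fix x assume "x \<in> S"
      then obtain i where i: "i < n" "x = xs ! i" using xs by (auto simp: in_set_conv_nth n_def)
      then show "L (vec_fun xs w) x = g x"
        using operator_mat_mult_vec[OF L, of w xs i] w Aw by (simp add: A_def n_def)
    qed
    show "\<forall>x. x \<notin> S \<longrightarrow> vec_fun xs w x = 0" using vec_fun_outside xs(1) by metis
  qed
qed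

section \<open>The Steklov operator of a connected graph\<close>

lemma linear_operator_laplacian: "linear_operator (laplacian G)"
  by (simp add: linear_operator_def laplacian_def fun_eq_iff sum.distrib[symmetric] sum_distrib_left
      algebra_simps)

section \<open>Leaves, and Green's formula for the Laplacian\<close>

context pair_graph
begin

lemma mem_leaves_iff: "x \<in> leaves G \<longleftrightarrow> x \<in> pverts G \<and> (\<exists>y. {y. (x, y) \<in> parcs G} = {y})"
proof -
  have "out_arcs (with_proj G) x = Pair x ` {y. (x, y) \<in> parcs G}"
    by (auto simp: out_arcs_def)
  then have "out_degree (with_proj G) x = card {y. (x, y) \<in> parcs G}"
    by (simp add: out_degree_def card_image inj_on_def)
  then show ?thesis by (auto simp: leaves_def card_1_singleton_iff)
qed

lemma leaves_subset: "leaves G \<subseteq> pverts G"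
  by (auto simp: leaves_def)

lemma finite_leaves: "finite (leaves G)"
  using leaves_subset pair_finite_verts finite_subset by blast

lemma laplacian_leaf:
  assumes "x \<in> leaves G" "(x, y) \<in> parcs G"
  shows "laplacian G u x = u x - u y"
proof -
  obtain z where "{y. (x, y) \<in> parcs G} = {z}" using assms(1) mem_leaves_iff by blast
  then have "{y. (x, y) \<in> parcs G} = {y}" using assms(2) by auto
  then show ?thesis by (simp add: laplacian_def)
qed

lemma leaf_list: "distinct (leaf_list G)" "set (leaf_list G) = leaves G"
proof -
  have "\<exists>xs. distinct xs \<and> set xs = leaves G"
    using finite_distinct_list[OF finite_leaves] by blast
  from someI_ex[OF this] show "distinct (leaf_list G)" "set (leaf_list G) = leaves G"
    by (auto simp: leaf_list_def)
qed

lemma length_leaf_list: "length (leaf_list G) = card (leaves G)"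
  using leaf_list distinct_card by metis

lemma steklov_mat_eq: "steklov_mat G = operator_mat (leaf_list G) (steklov G)"
  by (simp add: steklov_mat_def operator_mat_def length_leaf_list)

lemma steklov_mat_carrier: "steklov_mat G \<in> carrier_mat (card (leaves G)) (card (leaves G))"
  by (simp add: steklov_mat_def)

text \<open>Green's formula. Each edge is stored as two arcs, whence the division by 2. Reversing
  all arcs shows that the two halves of the product on the right have equal sums.\<close>

lemma sum_laplacian_mult:
  "(\<Sum>x\<in>pverts G. laplacian G u x * v x) = (\<Sum>(x, y)\<in>parcs G. (u x - u y) * (v x - v y)) / 2"
proof -
  have arcs: "parcs G = Sigma (pverts G) (\<lambda>x. {y. (x, y) \<in> parcs G})"
    using wellformed by force
  have fin: "finite {y. (x, y) \<in> parcs G}" for x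
    by (rule finite_subset[OF _ pair_finite_verts]) (use wellformed in force)
  have "(\<Sum>x\<in>pverts G. laplacian G u x * v x)
      = (\<Sum>x\<in>pverts G. \<Sum>y | (x, y) \<in> parcs G. (u x - u y) * v x)"
    by (simp add: laplacian_def sum_distrib_right)
  also have "\<dots> = (\<Sum>(x, y)\<in>Sigma (pverts G) (\<lambda>x. {y. (x, y) \<in> parcs G}). (u x - u y) * v x)"
    using fin pair_finite_verts by (intro sum.Sigma) auto
  finally have 1: "(\<Sum>x\<in>pverts G. laplacian G u x * v x) = (\<Sum>(x, y)\<in>parcs G. (u x - u y) * v x)"
    by (simp only: arcs[symmetric])
  also have "\<dots> = (\<Sum>(x, y)\<in>parcs G. (u y - u x) * v y)"
    by (rule sum.reindex_bij_witness[where i = prod.swap and j = prod.swap])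
      (auto intro: arcs_symmetric)
  finally have 2: "(\<Sum>x\<in>pverts G. laplacian G u x * v x) = (\<Sum>(x, y)\<in>parcs G. (u y - u x) * v y)" .
  have "(\<Sum>(x, y)\<in>parcs G. (u x - u y) * (v x - v y))
      = (\<Sum>(x, y)\<in>parcs G. (u x - u y) * v x) + (\<Sum>(x, y)\<in>parcs G. (u y - u x) * v y)"
    unfolding sum.distrib[symmetric] by (intro sum.cong) (auto simp: algebra_simps)
  then show ?thesis using 1 2 by simp
qed

lemma sum_laplacian_mult_commute:
  "(\<Sum>x\<in>pverts G. laplacian G u x * v x) = (\<Sum>x\<in>pverts G. laplacian G v x * u x)"
  unfolding sum_laplacian_mult by (simp add: mult.commute)

end

section \<open>Harmonic extensions and the Steklov operator under connectedness\<close>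

locale connected_pair_graph = pair_graph G for G :: "'a pair_pre_digraph" +
  assumes connected: "Digraph_Component.connected (with_proj G)"
    and leaves_nonempty: "leaves G \<noteq> {}"
begin

text \<open>The codomain of \<open>u\<close> is arbitrary. Real values serve the uniqueness of
  harmonic extensions; truth values show that a nonempty vertex set closed under adjacency contains
  every vertex.\<close>

lemma locally_constant_imp_constant:
  assumes "\<And>x y. (x, y) \<in> parcs G \<Longrightarrow> u x = u y" "x \<in> pverts G" "y \<in> pverts G"
  shows "u x = u y"
proof -
  have "strongly_connected (with_proj G)"
    using symmetric_connected_imp_strongly_connected[OF sym_arcs connected] .
  then have "x \<rightarrow>\<^sup>*\<^bsub>with_proj G\<^esub> y" using assms(2,3) by (auto simp: strongly_connected_def)
  then show ?thesis by (induction rule: reachable_induct) (use assms(1) in auto)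
qed

text \<open>In each summand of the energy of \<open>u\<close> one factor vanishes, so the energy is
  0 and \<open>u\<close> is constant along arcs. Connectedness makes it constant, and a leaf, which
  exists by \<open>leaves_nonempty\<close>, fixes the constant as 0.\<close>

lemma harmonic_zero_boundary:
  assumes "\<forall>x\<in>leaves G. u x = 0" "\<forall>x\<in>pverts G - leaves G. laplacian G u x = 0" "x \<in> pverts G"
  shows "u x = 0"
proof -
  have "(\<Sum>x\<in>pverts G. laplacian G u x * u x) = 0"
    using assms(1,2) by (intro sum.neutral) auto
  then have "(\<Sum>(x, y)\<in>parcs G. (u x - u y) * (u x - u y)) = 0"
    by (simp add: sum_laplacian_mult)
  then have "\<forall>a\<in>parcs G. (u (fst a) - u (snd a)) * (u (fst a) - u (snd a)) = 0"
    by (subst (asm) sum_nonneg_eq_0_iff) (auto simp: pair_finite_arcs split_beta)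
  then have arc: "u x = u y" if "(x, y) \<in> parcs G" for x y
    using that by force
  obtain z where "z \<in> leaves G" using leaves_nonempty by blast
  then show ?thesis
    using locally_constant_imp_constant[of u x z, OF arc] assms leaves_subset by auto
qed

text \<open>The condition under the definite description in \<open>harmonic_extension\<close>. As a
  relation it can be shown linear before existence and uniqueness are known.\<close>

definition is_harmonic_extension :: "('a \<Rightarrow> real) \<Rightarrow> ('a \<Rightarrow> real) \<Rightarrow> bool" where
  "is_harmonic_extension f h \<longleftrightarrow>
     (\<forall>x\<in>leaves G. h x = f x) \<and> (\<forall>x\<in>pverts G - leaves G. laplacian G h x = 0) \<and>
     (\<forall>x. x \<notin> pverts G \<longrightarrow> h x = 0)"

lemma is_harmonic_extension_add_scaled:
  assumes "is_harmonic_extension f h" "is_harmonic_extension g k"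
  shows "is_harmonic_extension (\<lambda>x. f x + c * g x) (\<lambda>x. h x + c * k x)"
  using assms
  by (simp add: is_harmonic_extension_def linear_operatorD[OF linear_operator_laplacian])

lemma is_harmonic_extension_unique:
  assumes "is_harmonic_extension f h" "is_harmonic_extension f k"
  shows "h = k"
proof
  fix x
  have "is_harmonic_extension (\<lambda>x. f x + - 1 * f x) (\<lambda>x. h x + - 1 * k x)"
    using assms by (rule is_harmonic_extension_add_scaled)
  then have "h x + - 1 * k x = 0"
    using harmonic_zero_boundary[of "\<lambda>x. h x + - 1 * k x" x]
    by (cases "x \<in> pverts G") (auto simp: is_harmonic_extension_def)
  then show "h x = k x" by simp
qed

lemma is_harmonic_extension_exists: "\<exists>h. is_harmonic_extension f h"
proof -
  \<comment> \<open>The boundary condition and harmonicity form a single square system on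
    \<open>pverts G\<close>; \<open>harmonic_zero_boundary\<close> says that its kernel is
    trivial.\<close>
  define L where "L = (\<lambda>u x. if x \<in> leaves G then u x else laplacian G u x)"
  have L: "linear_operator L"
    by (auto simp: linear_operator_def L_def linear_operatorD[OF linear_operator_laplacian])
  have inj: "u x = 0" if "\<forall>x\<in>pverts G. L u x = 0" "x \<in> pverts G" for u x
  proof (rule harmonic_zero_boundary)
    show "\<forall>x\<in>leaves G. u x = 0"
    proof
      fix x assume "x \<in> leaves G"
      then show "u x = 0" using bspec[OF that(1), of x] leaves_subset by (auto simp: L_def)
    qed
    show "\<forall>x\<in>pverts G - leaves G. laplacian G u x = 0"
    proof
      fix x assume "x \<in> pverts G - leaves G"
      then show "laplacian G u x = 0" using bspec[OF that(1), of x] by (auto simp: L_def)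
    qed
  qed (fact that(2))
  obtain h where h: "\<forall>x\<in>pverts G. L h x = (if x \<in> leaves G then f x else 0)"
    "\<forall>x. x \<notin> pverts G \<longrightarrow> h x = 0"
    using linear_operator_injective_imp_surjective[OF L pair_finite_verts,
        where g = "\<lambda>x. if x \<in> leaves G then f x else 0"] inj by blast
  have "h x = f x" if "x \<in> leaves G" for x
    using bspec[OF h(1), of x] that leaves_subset by (auto simp: L_def)
  moreover have "laplacian G h x = 0" if "x \<in> pverts G - leaves G" for x
    using bspec[OF h(1), of x] that by (auto simp: L_def)
  ultimately have "is_harmonic_extension f h"
    using h(2) by (simp add: is_harmonic_extension_def)
  then show ?thesis by blast
qed

lemma harmonic_extension_eq_iff: "harmonic_extension G f = h \<longleftrightarrow> is_harmonic_extension f h"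
proof -
  have "\<exists>!h. is_harmonic_extension f h"
    using is_harmonic_extension_exists is_harmonic_extension_unique by blast
  from theI'[OF this] is_harmonic_extension_unique show ?thesis
    unfolding harmonic_extension_def is_harmonic_extension_def[symmetric] by blast
qed

lemma is_harmonic_extension_harmonic_extension: "is_harmonic_extension f (harmonic_extension G f)"
  using harmonic_extension_eq_iff by blast

lemma harmonic_extension_leaf: "x \<in> leaves G \<Longrightarrow> harmonic_extension G f x = f x"
  using is_harmonic_extension_harmonic_extension is_harmonic_extension_def by blast

lemma linear_operator_steklov: "linear_operator (steklov G)"
  unfolding linear_operator_def
proof (intro allI)
  fix f g c
  have "harmonic_extension G (\<lambda>x. f x + c * g x)
      = (\<lambda>x. harmonic_extension G f x + c * harmonic_extension G g x)"
    by (simp add: harmonic_extension_eq_iff is_harmonic_extension_add_scaled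
        is_harmonic_extension_harmonic_extension)
  then show "steklov G (\<lambda>x. f x + c * g x) = (\<lambda>x. steklov G f x + c * steklov G g x)"
    unfolding steklov_def using linear_operator_laplacian[of G] by (simp add: linear_operator_def)
qed

text \<open>The Laplacian of a harmonic extension vanishes off the leaves, so the values of
  \<open>v\<close> there are free. Below, \<open>v\<close> is taken both harmonic and zero in the
  interior.\<close>

lemma sum_steklov_mult:
  assumes "\<And>x. x \<in> leaves G \<Longrightarrow> v x = g x"
  shows "(\<Sum>x\<in>leaves G. steklov G f x * g x)
       = (\<Sum>x\<in>pverts G. laplacian G (harmonic_extension G f) x * v x)"
  using is_harmonic_extension_harmonic_extension[of f] assms
  by (intro sum.mono_neutral_cong_left[OF pair_finite_verts leaves_subset])
    (auto simp: steklov_def is_harmonic_extension_def)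

text \<open>Extending the second function harmonically as well turns both sides into values of the
  symmetric form of Green's formula.\<close>

lemma steklov_symmetric:
  "(\<Sum>x\<in>leaves G. steklov G f x * g x) = (\<Sum>x\<in>leaves G. steklov G g x * f x)"
proof -
  have "(\<Sum>x\<in>leaves G. steklov G f x * g x)
      = (\<Sum>x\<in>pverts G. laplacian G (harmonic_extension G f) x * harmonic_extension G g x)" for f g
    by (rule sum_steklov_mult) (rule harmonic_extension_leaf)
  then show ?thesis using sum_laplacian_mult_commute by simp
qed

lemma steklov_mat_symmetric:
  assumes "i < card (leaves G)" "j < card (leaves G)"
  shows "steklov_mat G $$ (i, j) = steklov_mat G $$ (j, i)"
proof -
  have eval: "(\<Sum>x\<in>leaves G. steklov G f x * (if x = leaf_list G ! i then 1 else 0))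
      = steklov G f (leaf_list G ! i)" if "i < card (leaves G)" for f i
  proof -
    have "leaf_list G ! i \<in> leaves G"
      using leaf_list(2) length_leaf_list that nth_mem by metis
    then show ?thesis using finite_leaves by (simp add: if_distrib cong: if_cong)
  qed
  show ?thesis
    using assms steklov_symmetric[of "\<lambda>x. if x = leaf_list G ! j then 1 else 0"
        "\<lambda>x. if x = leaf_list G ! i then 1 else 0"]
    by (simp add: steklov_mat_def eval)
qed

text \<open>This guarantees that the list in \<open>steklov_eigenvalue\<close> has an entry for each
  \<open>k\<close> from 1 to the number of leaves.\<close>

lemma size_proots_steklov_mat: "size (proots (char_poly (steklov_mat G))) = card (leaves G)"
  using steklov_mat_carrier steklov_mat_symmetric by (rule size_proots_char_poly_symmetric)

lemma char_poly_steklov_mat_nonzero: "char_poly (steklov_mat G) \<noteq> 0"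
  using degree_monic_char_poly[OF steklov_mat_carrier] by force

text \<open>Two adjacent leaves have no other neighbours and so form a whole component;
  connectedness would leave only these two vertices.\<close>

lemma neighbour_of_leaf_not_leaf:
  assumes "card (leaves G) \<ge> 3" "x \<in> leaves G" "(x, y) \<in> parcs G"
  shows "y \<notin> leaves G"
proof
  assume y: "y \<in> leaves G"
  have yx: "(y, x) \<in> parcs G" using assms(3) arcs_symmetric by auto
  have nbx: "{z. (x, z) \<in> parcs G} = {y}" and nby: "{z. (y, z) \<in> parcs G} = {x}"
    using assms(2,3) y yx mem_leaves_iff by (metis mem_Collect_eq singletonD)+
  have "pverts G \<subseteq> {x, y}"
  proof
    fix z assume z: "z \<in> pverts G"
    have "(x \<in> {x, y}) = (z \<in> {x, y})"
    proof (rule locally_constant_imp_constant[where u = "\<lambda>w. w \<in> {x, y}"])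
      fix v w assume vw: "(v, w) \<in> parcs G"
      then have "(w, v) \<in> parcs G" using arcs_symmetric by auto
      with vw nbx nby show "(v \<in> {x, y}) = (w \<in> {x, y})" by blast
    qed (use z assms(2) leaves_subset in auto)
    then show "z \<in> {x, y}" by simp
  qed
  then have "card (leaves G) \<le> card {x, y}"
    using leaves_subset by (intro card_mono) auto
  also have "\<dots> \<le> 2" by (simp add: card_insert_if)
  finally show False using assms(1) by simp
qed

text \<open>With \<open>f\<close> an eigenfunction extended by 0 and \<open>h\<close> its harmonic
  extension, the Dirichlet principle is the inequality 0 <= E(h - f, h - f). Expanded, it reads 0 <=
  q - s q, where \<open>q > 0\<close> is the squared norm of \<open>f\<close>.\<close>

lemma steklov_mat_eigenvalue_le_1:
  assumes "card (leaves G) \<ge> 3" "poly (char_poly (steklov_mat G)) s = 0"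
  shows "s \<le> 1"
proof -
  define n where "n = card (leaves G)"
  have "eigenvalue (steklov_mat G) s"
    using assms(2) eigenvalue_root_char_poly[OF steklov_mat_carrier] by blast
  then obtain w where w: "w \<in> carrier_vec n" "w \<noteq> 0\<^sub>v n" "steklov_mat G *\<^sub>v w = s \<cdot>\<^sub>v w"
    using steklov_mat_carrier by (auto simp: eigenvalue_def eigenvector_def n_def)
  define f where "f = vec_fun (leaf_list G) w"
  define h where "h = harmonic_extension G f"
  define q where "q = (\<Sum>x\<in>leaves G. (f x)\<^sup>2)"
  let ?E = "\<lambda>u v. \<Sum>x\<in>pverts G. laplacian G u x * v x"
  have f_nth: "f (leaf_list G ! i) = w $ i" if "i < n" for i
    unfolding f_def using that leaf_list(1) length_leaf_list by (simp add: vec_fun_nth n_def)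
  have leaf_nth: "\<exists>i<n. x = leaf_list G ! i" if "x \<in> leaves G" for x
    using that leaf_list(2) length_leaf_list by (metis in_set_conv_nth n_def)
  have nth_leaf: "leaf_list G ! i \<in> leaves G" if "i < n" for i
    using that leaf_list(2) length_leaf_list by (metis nth_mem n_def)
  have f0: "f x = 0" if "x \<notin> leaves G" for x
    using that leaf_list(2) by (simp add: f_def vec_fun_outside)
  have ev: "steklov G f x = s * f x" if x: "x \<in> leaves G" for x
  proof -
    obtain i where i: "i < n" "x = leaf_list G ! i" using leaf_nth[OF x] by blast
    then have "steklov G f x = (steklov_mat G *\<^sub>v w) $ i"
      using operator_mat_mult_vec[OF linear_operator_steklov, of w "leaf_list G" i] w
      by (simp add: steklov_mat_eq f_def length_leaf_list n_def)
    then show ?thesis using w i f_nth by simp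
  qed
  \<comment> \<open>Both \<open>f\<close> and \<open>h\<close> are admissible for \<open>v\<close>,
    so the cross terms and the energy of \<open>h\<close> all equal \<open>s * q\<close>.\<close>
  have Eh: "?E h v = s * q" if "\<And>x. x \<in> leaves G \<Longrightarrow> v x = f x" for v
  proof -
    have "?E h v = (\<Sum>x\<in>leaves G. steklov G f x * f x)"
      unfolding h_def using that by (rule sum_steklov_mult[symmetric])
    also have "\<dots> = s * q"
      by (simp add: q_def sum_distrib_left ev power2_eq_square mult.assoc)
    finally show ?thesis .
  qed
  have Ehf: "?E h f = s * q" by (rule Eh) simp
  have Ehh: "?E h h = s * q" by (rule Eh) (simp add: h_def harmonic_extension_leaf)
  \<comment> \<open>The neighbour of a leaf is interior, where \<open>f\<close> is 0, so the
    Laplacian of \<open>f\<close> at a leaf is the value of \<open>f\<close> itself.\<close>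
  have Eff: "?E f f = q"
  proof -
    have "?E f f = (\<Sum>x\<in>leaves G. laplacian G f x * f x)"
      using f0 by (intro sum.mono_neutral_right[OF pair_finite_verts leaves_subset]) auto
    also have "\<dots> = q"
      unfolding q_def
    proof (rule sum.cong[OF refl])
      fix x assume x: "x \<in> leaves G"
      then obtain y where xy: "(x, y) \<in> parcs G" using mem_leaves_iff by blast
      then have "f y = 0" using f0 neighbour_of_leaf_not_leaf[OF assms(1) x] by blast
      then show "laplacian G f x * f x = (f x)\<^sup>2"
        using laplacian_leaf[OF x xy] by (simp add: power2_eq_square)
    qed
    finally show ?thesis .
  qed
  have Efh: "?E f h = ?E h f" by (rule sum_laplacian_mult_commute)
  have "0 \<le> ?E (\<lambda>x. h x + - 1 * f x) (\<lambda>x. h x + - 1 * f x)"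
    by (simp only: sum_laplacian_mult) (auto intro!: sum_nonneg)
  also have "\<dots> = ?E h h - ?E h f - ?E f h + ?E f f"
    unfolding linear_operatorD[OF linear_operator_laplacian]
    by (simp add: algebra_simps sum.distrib sum_subtractf)
  also have "\<dots> = q - s * q" using Efh Ehf Ehh Eff by simp
  finally have "s * q \<le> q" by simp
  moreover have "q > 0"
  proof -
    obtain i where i: "i < n" "w $ i \<noteq> 0"
      using w(1,2) by (metis carrier_vecD eq_vecI index_zero_vec)
    then have "(f (leaf_list G ! i))\<^sup>2 > 0" using f_nth by simp
    also have "(f (leaf_list G ! i))\<^sup>2 \<le> q"
      unfolding q_def using nth_leaf[OF i(1)] finite_leaves by (intro member_le_sum) auto
    finally show ?thesis .
  qed
  ultimately show ?thesis by simp
qed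

lemma steklov_eigenvalue_le_1:
  assumes "card (leaves G) \<ge> 3" "1 \<le> k" "k \<le> card (leaves G)"
  shows "steklov_eigenvalue G k \<le> 1"
proof -
  let ?M = "proots (char_poly (steklov_mat G))"
  have "k - 1 < length (sorted_list_of_multiset ?M)"
    using assms size_proots_steklov_mat by (metis Suc_diff_1 Suc_le_eq less_le_trans diff_less
        less_numeral_extra(1) mset_sorted_list_of_multiset size_mset order_less_le_trans)
  then have "steklov_eigenvalue G k \<in># ?M"
    unfolding steklov_eigenvalue_def by (metis mset_sorted_list_of_multiset nth_mem set_mset_mset)
  then show ?thesis
    using steklov_mat_eigenvalue_le_1[OF assms(1)] char_poly_steklov_mat_nonzero by simp
qed

text \<open>At a leaf next to \<open>z\<close>, the row of the characteristic matrix is X - 1 on the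
  diagonal plus a row that depends only on \<open>z\<close>. Rows of two such leaves thus agree
  modulo X - 1. One leaf serves as the reference row \<open>l\<close>, which costs 1 in the
  count.\<close>

lemma order_1_steklov_mat_ge:
  assumes "S \<subseteq> leaves G" "\<And>x. x \<in> S \<Longrightarrow> (x, z) \<in> parcs G"
  shows "card S - 1 \<le> order 1 (char_poly (steklov_mat G))"
proof (cases "S = {}")
  case False
  define n where "n = card (leaves G)"
  define xs where "xs = leaf_list G"
  have xs: "distinct xs" "set xs = leaves G" "length xs = n"
    using leaf_list length_leaf_list by (auto simp: xs_def n_def)
  obtain l where l: "l < n" "xs ! l \<in> S"
    using False assms(1) xs by (metis all_not_in_conv in_set_conv_nth subset_eq)
  define R where "R = {i. i < n \<and> xs ! i \<in> S - {xs ! l}}"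
  let ?M = "char_poly_matrix (steklov_mat G)"
  define e where "e j = (\<lambda>x. if x = xs ! j then 1 else 0 :: real)" for j
  have entry: "?M $$ (i, j)
      = (if i = j then [:- 1, 1:] else 0) + [:harmonic_extension G (e j) z:]"
    if "i < n" "j < n" "xs ! i \<in> S" for i j
  proof -
    have "steklov_mat G $$ (i, j) = steklov G (e j) (xs ! i)"
      using that by (simp add: steklov_mat_def n_def xs_def e_def)
    also have "\<dots> = e j (xs ! i) - harmonic_extension G (e j) z"
      using that assms laplacian_leaf[of "xs ! i" z] harmonic_extension_leaf[of "xs ! i"]
      by (auto simp: steklov_def)
    also have "e j (xs ! i) = (if i = j then 1 else 0)"
      using that xs by (simp add: e_def nth_eq_iff_index_eq)
    finally show ?thesis
      using that steklov_mat_carrier by (simp add: char_poly_matrix_def n_def)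
  qed
  have "(\<lambda>i. xs ! i) ` R = S - {xs ! l}"
  proof (intro equalityI subsetI)
    fix x assume x: "x \<in> S - {xs ! l}"
    then obtain i where "i < n" "x = xs ! i" using assms(1) xs by (metis DiffD1 in_set_conv_nth subsetD)
    with x show "x \<in> (\<lambda>i. xs ! i) ` R" by (auto simp: R_def)
  qed (auto simp: R_def)
  moreover have "inj_on (\<lambda>i. xs ! i) R"
    using xs by (auto simp: R_def inj_on_def nth_eq_iff_index_eq)
  ultimately have "card R = card (S - {xs ! l})"
    using card_image by metis
  then have card_R: "card R = card S - 1" using l by simp
  have "[:- 1, 1:] ^ card R dvd char_poly (steklov_mat G)"
    unfolding char_poly_def
  proof (rule power_dvd_det_if_rows_congruent)
    show "?M \<in> carrier_mat n n" using steklov_mat_carrier by (simp add: n_def)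
    show "[:- 1, 1:] dvd ?M $$ (i, j) - ?M $$ (l, j)" if "i \<in> R" "j < n" for i j
      using that l entry by (auto simp: R_def)
  qed (use l in \<open>auto simp: R_def\<close>)
  then show ?thesis
    using char_poly_steklov_mat_nonzero card_R by (metis order_max)
qed simp

end

section \<open>The spider with one long leg\<close>

text \<open>Weak duality: choosing a cover vertex in each edge of a matching is injective because
  the edges are disjoint. Hence no matching is larger than \<open>C\<close>, and \<open>M\<close>
  attains the bound.\<close>

lemma matching_number_eq_if_vertex_cover:
  assumes "finite (undirected_edges G)"
    and "M \<subseteq> undirected_edges G" "pairwise disjnt M"
    and "finite C" "card C \<le> card M" "\<And>e. e \<in> undirected_edges G \<Longrightarrow> e \<inter> C \<noteq> {}"
  shows "matching_number G = card M"
  unfolding matching_number_def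
proof (rule Max_eqI)
  show "finite (card ` {M. M \<subseteq> undirected_edges G \<and> pairwise disjnt M})"
    using assms(1) by simp
  show "card M \<in> card ` {M. M \<subseteq> undirected_edges G \<and> pairwise disjnt M}"
    using assms(2,3) by blast
next
  fix k assume "k \<in> card ` {M. M \<subseteq> undirected_edges G \<and> pairwise disjnt M}"
  then obtain N where N: "N \<subseteq> undirected_edges G" "pairwise disjnt N" "k = card N" by blast
  define c where "c e = (SOME x. x \<in> e \<inter> C)" for e
  have c: "c e \<in> e \<inter> C" if "e \<in> N" for e
    unfolding c_def using assms(6) N(1) that by (intro some_in_eq[THEN iffD2]) blast
  have "inj_on c N"
    using c N(2) by (intro inj_onI) (metis IntD1 disjnt_iff pairwiseD)
  moreover have "c ` N \<subseteq> C" using c by blast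
  ultimately have "card N \<le> card C" using assms(4) card_inj_on_le by blast
  then show "k \<le> card M" using N(3) assms(5) by simp
qed

text \<open>The long leg has arbitrary length \<open>n\<close>; its odd length
  \<open>2 * m - 1\<close> enters only with the matching number.\<close>

definition broom_graph :: "nat \<Rightarrow> nat \<Rightarrow> (nat \<times> nat) pair_pre_digraph" where
  "broom_graph b n = spider 1 (b - 1) n 1"

section \<open>Vertices, leaves, connectedness, spectrum and matchings of the spider\<close>

locale broom =
  fixes b n :: nat
  assumes b: "b \<ge> 3" and n: "n \<ge> 1"
begin

abbreviation "G \<equiv> broom_graph b n"

lemma mem_pverts: "(i, j) \<in> pverts G \<longleftrightarrow> i = 0 \<and> j \<le> n \<or> 0 < i \<and> i < b \<and> j = 1"
proof
  assume "(i, j) \<in> pverts G"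
  then obtain i' j' where "(i, j) = spider_vertex i' j'" "i' < b" "j' \<le> spider_leg 1 n 1 i'"
    using b by (auto simp: broom_graph_def spider_def)
  then show "i = 0 \<and> j \<le> n \<or> 0 < i \<and> i < b \<and> j = 1"
    by (auto simp: spider_vertex_def spider_leg_def split: if_splits)
next
  assume "i = 0 \<and> j \<le> n \<or> 0 < i \<and> i < b \<and> j = 1"
  then have "(i, j) = spider_vertex i j" "i < b" "j \<le> spider_leg 1 n 1 i"
    using b by (auto simp: spider_vertex_def spider_leg_def)
  then show "(i, j) \<in> pverts G" using b by (auto simp: broom_graph_def spider_def)
qed

lemma mem_spider_arcs: "((i, j), (i', j')) \<in> spider_arcs 1 (b - 1) n 1 \<longleftrightarrow>
    i = 0 \<and> i' = 0 \<and> j' = Suc j \<and> j < n \<or> i = 0 \<and> j = 0 \<and> 0 < i' \<and> i' < b \<and> j' = 1"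
proof
  assume "((i, j), (i', j')) \<in> spider_arcs 1 (b - 1) n 1"
  then obtain p q where "(i, j) = spider_vertex p q" "(i', j') = spider_vertex p (Suc q)"
    "p < b" "q < spider_leg 1 n 1 p"
    using b by (auto simp: spider_arcs_def)
  then show "i = 0 \<and> i' = 0 \<and> j' = Suc j \<and> j < n \<or> i = 0 \<and> j = 0 \<and> 0 < i' \<and> i' < b \<and> j' = 1"
    by (auto simp: spider_vertex_def spider_leg_def split: if_splits)
next
  assume "i = 0 \<and> i' = 0 \<and> j' = Suc j \<and> j < n \<or> i = 0 \<and> j = 0 \<and> 0 < i' \<and> i' < b \<and> j' = 1"
  then have "(i, j) = spider_vertex i' j" "(i', j') = spider_vertex i' (Suc j)"
    "i' < b" "j < spider_leg 1 n 1 i'"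
    using b by (auto simp: spider_vertex_def spider_leg_def)
  then show "((i, j), (i', j')) \<in> spider_arcs 1 (b - 1) n 1"
    using b by (auto simp: spider_arcs_def)
qed

lemma mem_parcs: "((i, j), (i', j')) \<in> parcs G \<longleftrightarrow>
    i = 0 \<and> i' = 0 \<and> (j' = Suc j \<and> j < n \<or> j = Suc j' \<and> j' < n) \<or>
    i = 0 \<and> j = 0 \<and> 0 < i' \<and> i' < b \<and> j' = 1 \<or> i' = 0 \<and> j' = 0 \<and> 0 < i \<and> i < b \<and> j = 1"
proof -
  have arcs: "parcs G = spider_arcs 1 (b - 1) n 1 \<union> (spider_arcs 1 (b - 1) n 1)\<inverse>"
    by (simp add: broom_graph_def spider_def)
  show ?thesis unfolding arcs Un_iff converse_iff mem_spider_arcs by blast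
qed

lemma finite_pverts: "finite (pverts G)"
proof (rule finite_subset)
  show "pverts G \<subseteq> {..b} \<times> {..n + 1}" using b by (auto simp: mem_pverts)
qed simp

lemma parcs_subset: "parcs G \<subseteq> pverts G \<times> pverts G"
  by (auto simp: mem_pverts mem_parcs)

sublocale pair_graph G
proof
  show "finite (pverts G)" by (rule finite_pverts)
  show "finite (parcs G)"
    using finite_subset[OF parcs_subset] finite_pverts by blast
  show "fst e \<in> pverts G" "snd e \<in> pverts G" if "e \<in> parcs G" for e
    using that parcs_subset by auto
  show "fst e \<noteq> snd e" if "e \<in> parcs G" for e
    using that by (cases e) (auto simp: mem_parcs)
  show "symmetric G"
    by (auto simp: symmetric_def sym_def mem_parcs)
qed

lemma leaves_eq: "leaves G = insert (0, n) ((\<lambda>i. (i, 1)) ` {1..<b})"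
proof (intro equalityI subsetI)
  fix x assume x: "x \<in> leaves G"
  obtain i j where ij: "x = (i, j)" by (cases x)
  from x obtain y where y: "{y. (x, y) \<in> parcs G} = {y}" and v: "x \<in> pverts G"
    using mem_leaves_iff by blast
  have uniq: "p = q" if "(x, p) \<in> parcs G" "(x, q) \<in> parcs G" for p q
    using that y by (metis mem_Collect_eq singletonD)
  show "x \<in> insert (0, n) ((\<lambda>i. (i, 1)) ` {1..<b})"
  proof (cases "i = 0")
    case True
    \<comment> \<open>Since \<open>b >= 3\<close>, the centre has at least the two distinct
      neighbours \<open>(1, 1)\<close> and \<open>(2, 1)\<close>.\<close>
    have "j \<noteq> 0"
      using uniq[of "(1, 1)" "(2, 1)"] b ij True by (auto simp: mem_parcs)
    moreover have "\<not> j < n"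
    proof
      assume "j < n"
      then have "(0 :: nat, j - 1) = (0, Suc j)"
        using ij True \<open>j \<noteq> 0\<close> by (intro uniq) (auto simp: mem_parcs)
      then show False by simp
    qed
    ultimately show ?thesis using v ij True by (auto simp: mem_pverts)
  next
    case False
    then show ?thesis using v ij by (auto simp: mem_pverts)
  qed
next
  fix x assume "x \<in> insert (0, n) ((\<lambda>i. (i, 1)) ` {1..<b})"
  then consider "x = (0, n)" | i where "x = (i, 1)" "0 < i" "i < b" by auto
  then show "x \<in> leaves G"
  proof cases
    case 1
    \<comment> \<open>For \<open>n = 1\<close> this neighbour is the centre itself.\<close>
    have "{y. (x, y) \<in> parcs G} = {(0, n - 1)}"
      using n 1 by (auto simp: mem_parcs)
    then show ?thesis using 1 mem_leaves_iff mem_pverts by blast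
  next
    case (2 i)
    have "{y. (x, y) \<in> parcs G} = {(0, 0)}"
      using 2 by (auto simp: mem_parcs)
    then show ?thesis using 2 mem_leaves_iff mem_pverts by blast
  qed
qed

lemma card_leaves: "card (leaves G) = b"
proof -
  have "card ((\<lambda>i. (i, 1 :: nat)) ` {1..<b}) = b - 1"
    by (simp add: card_image inj_on_def)
  moreover have "(0, n) \<notin> (\<lambda>i. (i, 1 :: nat)) ` {1..<b}" by auto
  ultimately show ?thesis using b unfolding leaves_eq by simp
qed

lemma reachable_from_centre:
  assumes "x \<in> pverts G"
  shows "(0, 0) \<rightarrow>\<^sup>*\<^bsub>with_proj G\<^esub> x"
proof -
  have path: "(0, 0) \<rightarrow>\<^sup>*\<^bsub>with_proj G\<^esub> (0, j)" if "j \<le> n" for j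
    using that
  proof (induction j)
    case 0
    then show ?case by (simp add: mem_pverts)
  next
    case (Suc j)
    then have "((0, j), (0, Suc j)) \<in> parcs G" by (simp add: mem_parcs)
    then show ?case using Suc reachable_adj_trans by simp
  qed
  obtain i j where ij: "x = (i, j)" by (cases x)
  show ?thesis
  proof (cases "i = 0")
    case False
    then have "((0, 0), x) \<in> parcs G" using assms ij by (simp add: mem_parcs mem_pverts)
    then show ?thesis by simp
  qed (use assms ij path in \<open>simp add: mem_pverts\<close>)
qed

text \<open>\<open>connected\<close> refers to strong connectivity of the symmetric closure, so
  paths through the centre are found in \<open>G\<close> and then carried over.\<close>

lemma connected_broom: "Digraph_Component.connected (with_proj G)"
  unfolding connected_def
proof (rule strongly_connectedI)
  show "verts (with_proj (mk_symmetric (with_proj G))) \<noteq> {}" using mem_pverts[of 0 0] by auto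
  fix x y
  assume "x \<in> verts (with_proj (mk_symmetric (with_proj G)))"
    "y \<in> verts (with_proj (mk_symmetric (with_proj G)))"
  then have xy: "x \<in> pverts G" "y \<in> pverts G" by simp_all
  have "x \<rightarrow>\<^sup>*\<^bsub>with_proj G\<^esub> (0, 0)"
    using symmetric_reachable[OF sym_arcs reachable_from_centre] xy(1) by simp
  also have "(0, 0) \<rightarrow>\<^sup>*\<^bsub>with_proj G\<^esub> y"
    using reachable_from_centre xy(2) by simp
  finally show "x \<rightarrow>\<^sup>*\<^bsub>with_proj (mk_symmetric (with_proj G))\<^esub> y"
    by (rule reachable_mk_symmetricI)
qed

sublocale connected_pair_graph G
proof
  show "Digraph_Component.connected (with_proj G)" by (rule connected_broom)
  show "leaves G \<noteq> {}" unfolding leaves_eq by blast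
qed

text \<open>The \<open>b - 1\<close> short legs end at leaves adjacent to the centre, so 1 has
  multiplicity at least \<open>b - 2\<close>. At most two eigenvalues are smaller, and
  \<open>k >= 3\<close> means list index at least 2.\<close>

lemma steklov_eigenvalue_eq_1:
  assumes "3 \<le> k" "k \<le> b"
  shows "steklov_eigenvalue G k = 1"
  unfolding steklov_eigenvalue_def
proof (rule sorted_nth_eq_max_if_count[where d = 2])
  let ?p = "char_poly (steklov_mat G)"
  let ?S = "(\<lambda>i. (i, 1 :: nat)) ` {1..<b}"
  show "s \<le> 1" if "s \<in># proots ?p" for s
  proof (rule steklov_mat_eigenvalue_le_1)
    show "3 \<le> card (leaves G)" using b by (simp only: card_leaves)
    show "poly ?p s = 0" using that char_poly_steklov_mat_nonzero by simp
  qed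
  have "card ?S = b - 1" by (simp add: card_image inj_on_def)
  moreover have "card ?S - 1 \<le> order 1 ?p"
    by (rule order_1_steklov_mat_ge[where z = "(0, 0)"]) (auto simp: leaves_eq mem_parcs)
  ultimately show "size (proots ?p) \<le> count (proots ?p) 1 + 2"
    unfolding count_proots[OF char_poly_steklov_mat_nonzero] size_proots_steklov_mat card_leaves
    by linarith
  show "k - 1 < size (proots ?p)"
    unfolding size_proots_steklov_mat card_leaves using assms by linarith
  show "2 \<le> k - 1" using assms by simp
qed

text \<open>The long leg together with the centre is a path on \<open>2 * m\<close> vertices,
  perfectly matched by \<open>M\<close>. The \<open>m\<close> vertices at even distance on it cover
  every edge, as the centre is one of them and covers the short legs.\<close>

lemma matching_number_eq:
  assumes "n = 2 * m - 1"
  shows "matching_number G = m"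
proof -
  define M where "M = (\<lambda>t. {(0 :: nat, 2 * t), (0, Suc (2 * t))}) ` {..<m}"
  define C where "C = (\<lambda>t. (0 :: nat, 2 * t)) ` {..<m}"
  have card_M: "card M = m"
  proof -
    have "inj_on (\<lambda>t. {(0 :: nat, 2 * t), (0, Suc (2 * t))}) {..<m}"
    proof (rule inj_onI)
      fix s t assume "{(0 :: nat, 2 * s), (0, Suc (2 * s))} = {(0, 2 * t), (0, Suc (2 * t))}"
      then have "2 * s = 2 * t \<or> 2 * s = Suc (2 * t)" by (auto simp: doubleton_eq_iff)
      then show "s = t" by presburger
    qed
    then show ?thesis by (simp add: M_def card_image)
  qed
  have "matching_number G = card M"
  proof (rule matching_number_eq_if_vertex_cover)
    have "undirected_edges G \<subseteq> Pow (pverts G)"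
      using parcs_subset by (auto simp: undirected_edges_def)
    then show "finite (undirected_edges G)" using finite_pverts finite_subset by blast
    show "M \<subseteq> undirected_edges G"
    proof
      fix e assume "e \<in> M"
      then obtain t where "t < m" "e = {(0, 2 * t), (0, Suc (2 * t))}" by (auto simp: M_def)
      moreover from this have "((0, 2 * t), (0, Suc (2 * t))) \<in> parcs G"
        using assms unfolding mem_parcs by simp
      ultimately show "e \<in> undirected_edges G" by (auto simp: undirected_edges_def)
    qed
    show "pairwise disjnt M"
    proof (rule pairwiseI)
      fix d e assume "d \<in> M" "e \<in> M" "d \<noteq> e"
      then obtain s t where st: "d = {(0, 2 * s), (0, Suc (2 * s))}"
        "e = {(0, 2 * t), (0, Suc (2 * t))}" "s \<noteq> t"
        by (auto simp: M_def)
      then have "Suc (2 * s) \<noteq> 2 * t" "2 * s \<noteq> Suc (2 * t)" by presburger+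
      with st show "disjnt d e" by (simp add: disjnt_def)
    qed
    show "finite C" by (simp add: C_def)
    show "card C \<le> card M"
      unfolding card_M C_def using card_image_le[of "{..<m}"] by simp
    show "e \<inter> C \<noteq> {}" if e: "e \<in> undirected_edges G" for e
    proof -
      have arc: "{x, y} \<inter> C \<noteq> {}" if "(x, y) \<in> spider_arcs 1 (b - 1) n 1" for x y
      proof -
        obtain i j i' j' where xy: "x = (i, j)" "y = (i', j')" by (cases x, cases y)
        have "i = 0 \<and> i' = 0 \<and> j' = Suc j \<and> j < n \<or> i = 0 \<and> j = 0 \<and> 0 < i' \<and> i' < b \<and> j' = 1"
          using that unfolding xy mem_spider_arcs .
        then consider "i = 0" "i' = 0" "j' = Suc j" "j < n" | "i = 0" "j = 0"
          by blast
        then have "\<exists>t<m. (0, 2 * t) \<in> {x, y}"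
        proof cases
          case 1
          show ?thesis
          proof (cases "even j")
            case True
            then show ?thesis using 1 xy assms by (intro exI[of _ "j div 2"]) auto
          next
            case False
            then obtain q where "j = 2 * q + 1" by (elim oddE)
            \<comment> \<open>For odd \<open>j\<close> the far end \<open>Suc j\<close> is even, and
              \<open>j < 2 * m - 1\<close> gives \<open>Suc q < m\<close>.\<close>
            then show ?thesis using 1 xy assms by (intro exI[of _ "Suc q"]) auto
          qed
        next
          case 2
          \<comment> \<open>\<open>n >= 1\<close> forces \<open>m > 0\<close>, so the centre belongs
            to \<open>C\<close>.\<close>
          then show ?thesis using xy assms n by (intro exI[of _ 0]) auto
        qed
        then show ?thesis by (auto simp: C_def)
      qed
      obtain x y where "e = {x, y}" "(x, y) \<in> parcs G"
        using e unfolding undirected_edges_def by blast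
      moreover from this(2)
      have "(x, y) \<in> spider_arcs 1 (b - 1) n 1 \<or> (y, x) \<in> spider_arcs 1 (b - 1) n 1"
        by (auto simp: broom_graph_def spider_def)
      ultimately show ?thesis using arc by (metis insert_commute)
    qed
  qed
  with card_M show ?thesis by simp
qed

end

theorem theorem1p4:
  fixes b m k :: nat
  assumes "b \<ge> k" and "k \<ge> 3" and "m \<ge> 1"
  shows "(\<forall>T :: 'a pair_pre_digraph.
            undirected_tree T \<and> card (leaves T) = b \<and> matching_number T = m
              \<longrightarrow> steklov_eigenvalue T k \<le> 1) \<and>
         card (leaves (spider 1 (b - 1) (2 * m - 1) 1)) = b \<and>
         matching_number (spider 1 (b - 1) (2 * m - 1) 1) = m \<and>
         steklov_eigenvalue (spider 1 (b - 1) (2 * m - 1) 1) k = 1"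
proof (intro conjI allI impI)
  fix T :: "'a pair_pre_digraph"
  assume T: "undirected_tree T \<and> card (leaves T) = b \<and> matching_number T = m"
  then have "connected_pair_graph T"
    using assms unfolding undirected_tree_def
    by (intro connected_pair_graph.intro connected_pair_graph_axioms.intro) auto
  then show "steklov_eigenvalue T k \<le> 1"
    by (rule connected_pair_graph.steklov_eigenvalue_le_1) (use T assms in auto)
next
  interpret broom b "2 * m - 1"
    using assms by unfold_locales auto
  show "card (leaves (spider 1 (b - 1) (2 * m - 1) 1)) = b" 
    using card_leaves by (simp add: broom_graph_def)
  show "matching_number (spider 1 (b - 1) (2 * m - 1) 1) = m" 
    using matching_number_eq[OF refl] by (simp add: broom_graph_def)
  show "steklov_eigenvalue (spider 1 (b - 1) (2 * m - 1) 1) k = 1"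
    using assms steklov_eigenvalue_eq_1 by (simp add: broom_graph_def)
qed

end
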